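(* Let $n\ge3$. Then (a) $P_n(0,0)=0$; (b) $P_n(\pm1,0)=1$; (c) $3\mid P_n(0,\pm1)$ if and only if $n=2\cdot3^m$ for some $m\ge1$; (d) $3\mid P_n(\pm1,1)$ if and only if $n=4\cdot3^m$ for some $m\ge0$; (e) $3\mid P_n(\pm1,-1)$ if and only if $n=3\cdot3^m$ for some $m\ge0$.
   Context: Let $\Phi_n(q)$ be the $n$th cyclotomic polynomial and $\phi$ the Euler totient function. For $n\ge 2$, $\Phi_n(q)$ is palindromic of degree $\phi(n)$ with constant term $1$, so there are unique complex numbers $\gamma_j$ with $\Phi_n(q)=\sum_{0\le j\le \phi(n)/2}\gamma_j q^j(1+q)^{\phi(n)-2j}$; the $n$th Lucas atom is $P_n(s,t)=\sum_j \gamma_j s^{\phi(n)-2j}(-t)^j$ (a polynomial with integer coefficients). *)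

theory Defs
  imports Complex_Main
    "HOL-Computational_Algebra.Polynomial"
    "HOL-Number_Theory.Totient"
begin

definition cyclotomic :: "nat \<Rightarrow> complex poly" where
  "cyclotomic n = (\<Prod>k\<in>totatives n. [:- cis (2 * pi * real k / real n), 1:])"

(* The coefficients of the expansion
     Phi_n(q) = sum over 0 <= j <= phi(n)/2 of gamma_j q^j (1+q)^(phi(n)-2j),
   extended by 0 beyond the index range so that they form a unique function on nat.
   They exist and are unique for n >= 2; for n = 1 there is no such expansion and the
   value is unspecified. *)
definition lucas_gamma :: "nat \<Rightarrow> nat \<Rightarrow> complex" where
  "lucas_gamma n = (THE g.
     (\<forall>j. totient n div 2 < j \<longrightarrow> g j = 0) \<and>
     cyclotomic n =
       (\<Sum>j\<le>totient n div 2. smult (g j) (monom 1 j * [:1, 1:] ^ (totient n - 2 * j))))"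

(* The polynomial P_n(s,t), as a polynomial function of two complex arguments. *)
definition lucas_atom :: "nat \<Rightarrow> complex \<Rightarrow> complex \<Rightarrow> complex" where
  "lucas_atom n s t =
     (\<Sum>j\<le>totient n div 2. lucas_gamma n j * s ^ (totient n - 2 * j) * (- t) ^ j)"

(* Divisibility in the ring of integers of a number that is given as a complex number;
   the relation dvd on the field of complex numbers itself would be trivial. *)
definition int_dvd :: "int \<Rightarrow> complex \<Rightarrow> bool" where
  "int_dvd d z \<longleftrightarrow> (\<exists>m::int. z = of_int m \<and> d dvd m)"

end

theory Submission
  imports Defs
begin

text \<open>
  Setting \<open>q = -1, 1, \<i>\<close> in \<open>P\<^sub>n(1 + q, -q) = \<Phi>\<^sub>n(q)\<close> gives the points
  \<open>(0, 1)\<close>, \<open>(2, -1)\<close> and \<open>(1 + \<i>, -\<i>)\<close>.  Since \<open>P\<^sub>n\<close> has integer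
  coefficients and is even in \<open>s\<close>, and since \<open>(1 + \<i>)\<^sup>2 = 2\<i>\<close> with \<open>2 \<equiv> -1\<close> modulo 3,
  the values in (c), (e) and (d) agree modulo 3, up to a unit of the Gaussian integers, with
  \<open>\<Phi>\<^sub>n(u)\<close> for \<open>u\<close> a primitive \<open>r\<close>-th root of unity, \<open>r = 2, 1, 4\<close>.

  It remains to see that 3 divides \<open>\<Phi>\<^sub>n(u)\<close> in the Gaussian integers iff \<open>n = r 3\<^sup>m\<close>.
  For \<open>M\<close> dividing \<open>N\<close>, the product of the \<open>\<Phi>\<^sub>d\<close> over the \<open>d\<close> dividing \<open>N\<close>
  but not \<open>M\<close> is \<open>(x\<^sup>N - 1) / (x\<^sup>M - 1)\<close>, which takes the value \<open>N / M\<close> at \<open>u\<close>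
  if \<open>r\<close> divides \<open>M\<close>.  If \<open>n = r 3\<^sup>a b\<close> with \<open>b > 1\<close> prime to 3, then \<open>\<Phi>\<^sub>n(u)\<close>
  therefore divides \<open>b\<close>; if \<open>r\<close> does not divide \<open>n\<close>, it divides \<open>u\<^sup>n - 1\<close>,
  whose real part is \<open>-1\<close> or \<open>-2\<close>.  For \<open>n = r 3\<^sup>m\<close>, \<open>m > 0\<close>, comparing the products
  for \<open>(N, M) = (n, n/3)\<close> and \<open>(n/2, n/6)\<close> isolates the factor \<open>\<Phi>\<^sub>n(u) = 3\<close>.
\<close>

section \<open>Cyclotomic polynomials\<close>

lemma cyclotomic_nonzero [simp]: "cyclotomic n \<noteq> 0"
  by (simp add: cyclotomic_def)

text \<open>Both sides have degree at most \<open>n\<close> and the same coefficient at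
  \<open>n\<close>, so agreement at the \<open>n\<close> roots of unity is enough.\<close>

lemma prod_roots_of_unity:
  assumes "n > 0"
  shows "(\<Prod>k\<in>{0<..n}. [:- cis (2 * pi * real k / real n), 1:]) = monom 1 n - 1"
proof (rule poly_eqI_degree_lead_coeff)
  let ?p = "\<Prod>k\<in>{0<..n}. [:- cis (2 * pi * real k / real n), 1:]"
  have deg: "degree ?p = n"
    by (simp add: degree_prod_sum_eq)
  show "degree ?p \<le> n"
    by (simp add: deg)
  have "lead_coeff ?p = 1"
    by (simp add: lead_coeff_prod)
  with deg assms show "coeff ?p n = coeff (monom 1 n - 1) n"
    by simp
  show "card {z::complex. z ^ n = 1} \<ge> n"
    using assms by (simp add: card_roots_unity_eq)
  show "degree (monom 1 n - 1 :: complex poly) \<le> n"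
    by (intro degree_diff_le) (auto simp: degree_monom_le)
  fix z :: complex
  assume z: "z \<in> {z. z ^ n = 1}"
  then obtain k where k: "k < n" "z = cis (2 * pi * real k / real n)"
    using bij_betw_roots_unity[OF assms] by (auto simp: bij_betw_def image_iff set_eq_iff)
  \<comment> \<open>The index range starts at 1, so the root 1 is represented by \<open>n\<close>
    instead of 0.\<close>
  define l where "l = (if k = 0 then n else k)"
  have "l \<in> {0<..n}" "cis (2 * pi * real l / real n) = z"
    using k assms by (auto simp: l_def)
  then have "poly ?p z = 0"
    by (auto simp: poly_prod intro!: prod_zero)
  with z show "poly ?p z = poly (monom 1 n - 1) z"
    by (simp add: poly_monom)
qed

text \<open>The linear factors over \<open>{0<..n}\<close> are sorted by the gcd of \<open>k\<close>
  with \<open>n\<close>; the fibre over \<open>d\<close> is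
  \<open>cyclotomic (n div d)\<close>.\<close>

lemma prod_cyclotomic_divisors:
  assumes "n > 0"
  shows "(\<Prod>d | d dvd n. cyclotomic d) = monom 1 n - 1"
proof -
  let ?f = "\<lambda>k. [:- cis (2 * pi * real k / real n), 1:]"
  have fin: "finite {d. d dvd n}"
    using assms by simp
  have fib: "(\<Prod>k\<in>{k\<in>{0<..n}. gcd k n = d}. ?f k) = cyclotomic (n div d)" if "d dvd n" for d
  proof -
    have "(\<Prod>k\<in>{k\<in>{0<..n}. gcd k n = d}. ?f k) = (\<Prod>k\<in>totatives (n div d). ?f (k * d))"
      using prod.reindex_bij_betw[OF bij_betw_totatives_gcd_eq[OF that assms], of ?f] by simp
    also have "\<dots> = cyclotomic (n div d)"
      unfolding cyclotomic_def
    proof (intro prod.cong refl)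
      fix k
      have "real (k * d) / real n = real k / real (n div d)"
        using that assms by (auto simp: field_simps elim!: dvdE)
      then have "2 * pi * real (k * d) / real n = 2 * pi * real k / real (n div d)"
        by (metis times_divide_eq_right)
      then show "?f (k * d) = [:- cis (2 * pi * real k / real (n div d)), 1:]"
        by simp
    qed
    finally show ?thesis .
  qed
  have "(\<Prod>d | d dvd n. cyclotomic d) = (\<Prod>d | d dvd n. cyclotomic (n div d))"
    using assms by (intro prod.reindex_bij_witness[of _ "(div) n" "(div) n"]) (auto elim: dvdE)
  also have "\<dots> = (\<Prod>d | d dvd n. \<Prod>k\<in>{k\<in>{0<..n}. gcd k n = d}. ?f k)"
    by (intro prod.cong refl) (use fib in simp)
  also have "\<dots> = (\<Prod>k\<in>{0<..n}. ?f k)"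
    using fin by (intro prod.group) auto
  finally show ?thesis
    by (simp only: prod_roots_of_unity[OF assms])
qed

text \<open>Quotient of the divisor products for \<open>N\<close> and \<open>M\<close>. The
  geometric sum can be evaluated even at zeros of \<open>monom 1 M - 1\<close>, where the quotient
  would read 0/0.\<close>

lemma prod_cyclotomic_not_dvd:
  assumes "N > 0" "M dvd N"
  shows "(\<Prod>d | d dvd N \<and> \<not> d dvd M. cyclotomic d) = (\<Sum>i<N div M. monom 1 M ^ i)"
proof -
  have M: "M > 0"
    using assms by (auto intro!: Nat.gr0I)
  have split: "{d. d dvd N} = {d. d dvd M} \<union> {d. d dvd N \<and> \<not> d dvd M}"
    using assms by (auto intro: dvd_trans)
  have "(\<Prod>d | d dvd N. cyclotomic d) =
      (\<Prod>d | d dvd M. cyclotomic d) * (\<Prod>d | d dvd N \<and> \<not> d dvd M. cyclotomic d)"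
    unfolding split using assms M by (subst prod.union_disjoint) auto
  then have "(monom 1 M - 1) * (\<Prod>d | d dvd N \<and> \<not> d dvd M. cyclotomic d) = monom 1 N - 1"
    by (simp only: prod_cyclotomic_divisors[OF assms(1)] prod_cyclotomic_divisors[OF M])
  also have "monom 1 N = (monom 1 M :: complex poly) ^ (N div M)"
    using assms by (simp add: monom_power)
  also have "\<dots> - 1 = (monom 1 M - 1) * (\<Sum>i<N div M. monom 1 M ^ i)"
    by (rule power_diff_1_eq)
  finally have "(monom 1 M - 1) * (\<Prod>d | d dvd N \<and> \<not> d dvd M. cyclotomic d) =
      (monom 1 M - 1) * (\<Sum>i<N div M. monom 1 M ^ i)" .
  moreover have "monom 1 M - 1 \<noteq> (0 :: complex poly)"
    using M by (simp flip: prod_cyclotomic_divisors)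
  ultimately show ?thesis
    by (simp only: mult_cancel_left simp_thms)
qed

text \<open>The case \<open>M = 1\<close>, with \<open>cyclotomic n\<close> split off for strong
  induction. Leaving out \<open>d = 1\<close> avoids the factor with constant term -1.\<close>

lemma prod_proper_cyclotomic_mult:
  assumes "n \<ge> 2"
  shows "(\<Prod>d | d dvd n \<and> 1 < d \<and> d < n. cyclotomic d) * cyclotomic n = (\<Sum>i<n. monom 1 i)"
proof -
  have "d = n \<or> 1 < d \<and> d < n" if "d dvd n" "d \<noteq> 1" for d
  proof -
    have "d \<le> n" "d \<noteq> 0"
      using that assms by (auto dest: dvd_imp_le intro!: Nat.gr0I)
    with that show ?thesis by linarith
  qed
  then have "{d. d dvd n \<and> \<not> d dvd 1} = insert n {d. d dvd n \<and> 1 < d \<and> d < n}"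
    using assms by auto
  then show ?thesis
    using prod_cyclotomic_not_dvd[of n 1] assms by (simp add: monom_power mult.commute)
qed

lemma coeff_0_cyclotomic:
  assumes "n \<ge> 2"
  shows "coeff (cyclotomic n) 0 = 1"
  using assms
proof (induction n rule: less_induct)
  case (less n)
  have "(\<Prod>d | d dvd n \<and> 1 < d \<and> d < n. poly (cyclotomic d) 0) = 1"
    using less.IH by (intro prod.neutral) (auto simp: poly_0_coeff_0)
  moreover have "(\<Sum>i<n. 0 ^ i :: complex) = 1"
    using less.prems by (cases n) (simp_all only: sum.lessThan_Suc_shift, simp_all)
  moreover have "poly ((\<Prod>d | d dvd n \<and> 1 < d \<and> d < n. cyclotomic d) * cyclotomic n) 0 =
      poly (\<Sum>i<n. monom 1 i) 0"
    by (simp only: prod_proper_cyclotomic_mult[OF less.prems])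
  ultimately have "poly (cyclotomic n) 0 = 1"
    by (simp only: poly_mult poly_prod poly_sum poly_monom mult_1)
  then show ?case
    by (simp add: poly_0_coeff_0)
qed

section \<open>Integrality of the cyclotomic coefficients\<close>

lemma coeff_mult_Ints:
  fixes p q :: "'a :: comm_ring_1 poly"
  assumes "\<And>i. coeff p i \<in> \<int>" "\<And>i. coeff q i \<in> \<int>"
  shows "coeff (p * q) i \<in> \<int>"
  unfolding coeff_mult using assms by (intro Ints_sum Ints_mult)

lemma coeff_prod_Ints:
  fixes p :: "'b \<Rightarrow> 'a :: comm_ring_1 poly"
  assumes "\<And>x i. x \<in> A \<Longrightarrow> coeff (p x) i \<in> \<int>"
  shows "coeff (prod p A) i \<in> \<int>"
  using assms
proof (induction A arbitrary: i rule: infinite_finite_induct)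
  case (insert x A)
  then show ?case
    by (auto intro!: coeff_mult_Ints)
qed (auto simp: coeff_1)

text \<open>Division from the low-order end works because the constant term is a unit.\<close>

lemma coeff_quotient_Ints:
  fixes p q :: "'a :: comm_ring_1 poly"
  assumes "coeff p 0 = 1" "\<And>i. coeff p i \<in> \<int>" "\<And>i. coeff (p * q) i \<in> \<int>"
  shows "coeff q i \<in> \<int>"
proof (induction i rule: less_induct)
  case (less i)
  have "coeff (p * q) i = coeff q i + (\<Sum>j<i. coeff p (Suc j) * coeff q (i - Suc j))"
    using assms(1) by (simp add: coeff_mult sum.atMost_shift)
  then have "coeff q i = coeff (p * q) i - (\<Sum>j<i. coeff p (Suc j) * coeff q (i - Suc j))"
    by simp
  also have "\<dots> \<in> \<int>"
    using assms less by (intro Ints_diff Ints_sum Ints_mult) auto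
  finally show ?case .
qed

text \<open>By strong induction, \<open>cyclotomic n\<close> is the quotient of an integer
  polynomial by one with constant term 1.\<close>

lemma coeff_cyclotomic_Ints:
  "coeff (cyclotomic n) i \<in> \<int>"
proof (induction n arbitrary: i rule: less_induct)
  case (less n)
  consider "n = 0" | "n = 1" | "n \<ge> 2" by linarith
  then show ?case
  proof cases
    case 3
    let ?p = "\<Prod>d | d dvd n \<and> 1 < d \<and> d < n. cyclotomic d"
    show ?thesis
    proof (rule coeff_quotient_Ints)
      have "(\<Prod>d | d dvd n \<and> 1 < d \<and> d < n. poly (cyclotomic d) 0) = 1"
        by (intro prod.neutral) (auto simp: poly_0_coeff_0 coeff_0_cyclotomic)
      then show "coeff ?p 0 = 1"
        by (simp add: poly_prod flip: poly_0_coeff_0)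
      show "coeff ?p i \<in> \<int>" for i
        using less.IH by (intro coeff_prod_Ints) auto
      show "coeff (?p * cyclotomic n) i \<in> \<int>" for i
        unfolding prod_proper_cyclotomic_mult[OF 3] by (auto simp: coeff_sum)
    qed
  qed (auto simp: cyclotomic_def coeff_pCons split: nat.split)
qed

section \<open>Divisibility by 3 in the Gaussian integers\<close>

definition gauss_ints :: "complex set" where
  "gauss_ints = {z. Re z \<in> \<int> \<and> Im z \<in> \<int>}"

lemma gauss_ints_add: "x \<in> gauss_ints \<Longrightarrow> y \<in> gauss_ints \<Longrightarrow> x + y \<in> gauss_ints"
  by (simp add: gauss_ints_def)

lemma gauss_ints_mult: "x \<in> gauss_ints \<Longrightarrow> y \<in> gauss_ints \<Longrightarrow> x * y \<in> gauss_ints"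
  by (simp add: gauss_ints_def)

lemma Ints_imp_gauss_ints: "x \<in> \<int> \<Longrightarrow> x \<in> gauss_ints"
  by (auto simp: gauss_ints_def elim: Ints_cases)

lemma gauss_ints_power: "x \<in> gauss_ints \<Longrightarrow> x ^ k \<in> gauss_ints"
  by (induction k) (auto intro: gauss_ints_mult Ints_imp_gauss_ints)

lemma gauss_ints_sum: "(\<And>i. i \<in> A \<Longrightarrow> f i \<in> gauss_ints) \<Longrightarrow> sum f A \<in> gauss_ints"
  by (induction A rule: infinite_finite_induct) (auto intro: gauss_ints_add Ints_imp_gauss_ints)

lemma gauss_ints_prod: "(\<And>i. i \<in> A \<Longrightarrow> f i \<in> gauss_ints) \<Longrightarrow> prod f A \<in> gauss_ints"
  by (induction A rule: infinite_finite_induct) (auto intro: gauss_ints_mult Ints_imp_gauss_ints)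

lemma poly_cyclotomic_gauss_ints:
  assumes "u \<in> gauss_ints"
  shows "poly (cyclotomic n) u \<in> gauss_ints"
  unfolding poly_altdef using assms
  by (intro gauss_ints_sum gauss_ints_mult gauss_ints_power
      Ints_imp_gauss_ints[OF coeff_cyclotomic_Ints])

definition three_dvd :: "complex \<Rightarrow> bool" where
  "three_dvd z \<longleftrightarrow> z / 3 \<in> gauss_ints"

lemma three_dvd_mult:
  "three_dvd x \<Longrightarrow> y \<in> gauss_ints \<Longrightarrow> three_dvd (x * y)"
  using gauss_ints_mult[of "x / 3" y] by (simp add: three_dvd_def)

lemma three_dvd_add: "three_dvd x \<Longrightarrow> three_dvd y \<Longrightarrow> three_dvd (x + y)"
  by (simp add: three_dvd_def add_divide_distrib gauss_ints_add)

lemma three_dvd_sum: "(\<And>i. i \<in> A \<Longrightarrow> three_dvd (f i)) \<Longrightarrow> three_dvd (sum f A)"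
  unfolding three_dvd_def sum_divide_distrib by (rule gauss_ints_sum)

lemma three_dvd_power_diff:
  assumes "three_dvd (a - b)" "a \<in> gauss_ints" "b \<in> gauss_ints"
  shows "three_dvd (a ^ k - b ^ k)"
proof (induction k)
  case (Suc k)
  have "a ^ Suc k - b ^ Suc k = (a - b) * a ^ k + (a ^ k - b ^ k) * b"
    by (simp add: algebra_simps)
  then show ?case
    using Suc assms by (auto intro!: three_dvd_add three_dvd_mult gauss_ints_power)
qed (simp add: three_dvd_def Ints_imp_gauss_ints)

lemma three_dvd_cong:
  assumes "three_dvd (x - y)"
  shows "three_dvd x \<longleftrightarrow> three_dvd y"
proof -
  have "three_dvd (y - x)"
    using three_dvd_mult[OF assms, of "-1"] by (simp add: Ints_imp_gauss_ints)
  then show ?thesis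
    using three_dvd_add[of x "y - x"] three_dvd_add[of y "x - y"] assms by auto
qed

lemma three_dvd_sum_cong:
  assumes "\<And>j. j \<in> A \<Longrightarrow> three_dvd (f j - h j)"
  shows "three_dvd (sum f A) \<longleftrightarrow> three_dvd (sum h A)"
  using three_dvd_sum[of A "\<lambda>j. f j - h j"] assms
  by (intro three_dvd_cong) (simp add: sum_subtractf)

lemma three_dvd_mult_unit:
  assumes "w \<in> gauss_ints" "w' \<in> gauss_ints" "w * w' = 1"
  shows "three_dvd (w * x) \<longleftrightarrow> three_dvd x"
proof
  assume "three_dvd (w * x)"
  then have "three_dvd (w * x * w')"
    using assms(2) by (rule three_dvd_mult)
  also have "w * x * w' = x"
    using assms(3) by (simp add: algebra_simps)
  finally show "three_dvd x" .
next
  assume "three_dvd x"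
  then show "three_dvd (w * x)"
    using assms three_dvd_mult[of x w] by (simp add: mult.commute)
qed

text \<open>Enlarging the ring creates no new divisibility between integers, so (c), (d) and (e) may
  be decided in the Gaussian integers.\<close>

lemma int_dvd_3_iff:
  "int_dvd 3 z \<longleftrightarrow> z \<in> \<int> \<and> three_dvd z"
proof -
  have "of_int m / 3 \<in> gauss_ints \<longleftrightarrow> 3 dvd m" for m
  proof
    assume "of_int m / 3 \<in> gauss_ints"
    then obtain k where "real_of_int m / 3 = of_int k"
      by (auto simp: gauss_ints_def elim: Ints_cases)
    then have "real_of_int m = of_int (3 * k)"
      by simp
    then have "m = 3 * k"
      by (simp only: of_int_eq_iff)
    then show "3 dvd m" by simp
  next
    assume "3 dvd m"
    then show "of_int m / 3 \<in> gauss_ints"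
      by (auto elim!: dvdE intro: Ints_imp_gauss_ints)
  qed
  then show ?thesis
    by (auto simp: int_dvd_def three_dvd_def elim!: Ints_cases)
qed

lemma three_dvd_Re:
  assumes "three_dvd z" "Re z = of_int k"
  shows "3 dvd k"
proof -
  obtain m where "Re z / 3 = of_int m"
    using assms(1) by (auto simp: three_dvd_def gauss_ints_def elim: Ints_cases)
  then have "real_of_int k = of_int (3 * m)"
    using assms(2) by simp
  then have "k = 3 * m"
    by (simp only: of_int_eq_iff)
  then show ?thesis by simp
qed

section \<open>Cyclotomic values at roots of unity of order 1, 2 and 4\<close>

text \<open>The condition \<open>r dvd 4\<close> selects the orders 1, 2, 4 of the units of the
  Gaussian integers. The bound on real parts later shows that 3 does not divide
  \<open>u ^ n - 1\<close>.\<close>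

lemma cis_order_dvd_4:
  assumes "r dvd 4" "u = cis (2 * pi / real r)"
  shows "u \<in> gauss_ints"
    and "u ^ k = 1 \<longleftrightarrow> r dvd k"
    and "\<not> r dvd k \<Longrightarrow> Re (u ^ k) = -1 \<or> Re (u ^ k) = 0"
    and "even r \<Longrightarrow> u ^ (r div 2) = -1"
proof -
  have "r \<le> 4"
    using assms(1) by (rule dvd_imp_le) simp
  then have "r = 0 \<or> r = 1 \<or> r = 2 \<or> r = 3 \<or> r = 4"
    by linarith
  then consider "r = 1" "u = 1" | "r = 2" "u = -1" | "r = 4" "u = \<i>"
    using assms by (elim disjE) auto
  note cs = this
  have i4: "\<i> ^ k = \<i> ^ (k mod 4)"
  proof -
    have "\<i> ^ k = \<i> ^ (4 * (k div 4) + k mod 4)" by simp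
    also have "\<dots> = \<i> ^ (k mod 4)"
      by (simp only: power_add power_mult) simp
    finally show ?thesis .
  qed
  have "k mod 4 < 4" by simp
  then have "k mod 4 = 0 \<or> k mod 4 = 1 \<or> k mod 4 = 2 \<or> k mod 4 = 3"
    by linarith
  then have i_cases: "4 dvd k \<and> \<i> ^ k = 1 \<or> \<not> 4 dvd k \<and> \<i> ^ k \<in> {\<i>, -1, -\<i>}"
    unfolding i4 dvd_eq_mod_eq_0 by (elim disjE) (simp_all add: power3_eq_cube)
  show "u \<in> gauss_ints"
    using cs by cases (auto simp: gauss_ints_def)
  show "even r \<Longrightarrow> u ^ (r div 2) = -1"
    using cs by cases auto
  show "u ^ k = 1 \<longleftrightarrow> r dvd k"
    using cs
  proof cases
    case 3
    with i_cases show ?thesis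
      by (auto simp: complex_eq_iff[of "-\<i>" 1])
  qed (auto simp: minus_one_power_iff)
  show "\<not> r dvd k \<Longrightarrow> Re (u ^ k) = -1 \<or> Re (u ^ k) = 0"
    using cs
  proof cases
    case 3
    with i_cases show "\<not> r dvd k \<Longrightarrow> Re (u ^ k) = -1 \<or> Re (u ^ k) = 0"
      by auto
  qed (auto simp: minus_one_power_iff)
qed

lemma three_dvd_cyclotomic_imp:
  assumes "r dvd 4" "n > 0" "three_dvd (poly (cyclotomic n) (cis (2 * pi / real r)))"
  shows "\<exists>m. n = r * 3 ^ m"
proof (cases "r dvd n")
  case True
  define u where "u = cis (2 * pi / real r)"
  note u = cis_order_dvd_4[OF assms(1) u_def]
  have "r > 0"
    using assms(1) by (auto intro!: Nat.gr0I)
  have "n div r \<noteq> 0"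
    using True assms by auto
  then obtain b where b: "n div r = 3 ^ multiplicity 3 (n div r) * b" "\<not> 3 dvd b"
    by (rule multiplicity_decompose'[of _ 3]) simp_all
  then obtain a where ab: "n div r = 3 ^ a * b" "\<not> 3 dvd b"
    by blast
  define M where "M = r * 3 ^ a"
  have n: "n = M * b"
    using ab True by (metis M_def dvd_mult_div_cancel mult.assoc)
  have M: "M dvd n" "M > 0"
    using \<open>r > 0\<close> by (auto simp: n M_def)
  have uM: "u ^ M = 1"
    by (simp add: u(2) M_def)
  show ?thesis
  proof (rule ccontr)
    assume contra: "\<not> ?thesis"
    \<comment> \<open>Since \<open>n\<close> differs from \<open>M\<close>, the factor
      \<open>cyclotomic n\<close> occurs in the product over \<open>?D\<close>.\<close>
    then have nM: "\<not> n dvd M"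
      using M dvd_antisym by (auto simp: M_def)
    let ?D = "{d. d dvd n \<and> \<not> d dvd M}"
    \<comment> \<open>All \<open>b\<close> summands are 1 at \<open>u\<close>, because
      \<open>u ^ M = 1\<close>.\<close>
    have "of_nat b = poly (\<Sum>i<n div M. monom 1 M ^ i) u"
      using M by (simp add: poly_sum poly_monom uM n)
    also have "\<dots> = (\<Prod>d\<in>?D. poly (cyclotomic d) u)"
      using prod_cyclotomic_not_dvd[OF \<open>n > 0\<close> M(1)] by (simp flip: poly_prod)
    also have "\<dots> = poly (cyclotomic n) u * (\<Prod>d\<in>?D - {n}. poly (cyclotomic d) u)"
      using nM \<open>n > 0\<close> by (intro prod.remove) auto
    finally have "three_dvd (of_nat b)"
      using assms(3) by (simp add: u_def three_dvd_mult gauss_ints_prod poly_cyclotomic_gauss_ints u(1)[unfolded u_def])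
    then have "3 dvd int b"
      by (rule three_dvd_Re) simp
    with ab(2) show False
      by presburger
  qed
next
  case False
  define u where "u = cis (2 * pi / real r)"
  note u = cis_order_dvd_4[OF assms(1) u_def]
  have "u ^ n - 1 = poly (\<Prod>d | d dvd n. cyclotomic d) u"
    by (simp add: prod_cyclotomic_divisors[OF \<open>n > 0\<close>] poly_monom)
  also have "\<dots> = poly (cyclotomic n) u * (\<Prod>d\<in>{d. d dvd n} - {n}. poly (cyclotomic d) u)"
    unfolding poly_prod using \<open>n > 0\<close> by (intro prod.remove) auto
  finally have dvd: "three_dvd (u ^ n - 1)"
    using assms(3) by (simp add: u_def three_dvd_mult gauss_ints_prod poly_cyclotomic_gauss_ints u(1)[unfolded u_def])
  from u(3)[OF False] have "Re (u ^ n - 1) = of_int (-2) \<or> Re (u ^ n - 1) = of_int (-1)"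
    by auto
  then show ?thesis
    using three_dvd_Re[OF dvd, of "-2"] three_dvd_Re[OF dvd, of "-1"] by auto
qed

text \<open>For odd \<open>r\<close>, \<open>?S\<close> contains only \<open>3 * K\<close>. For even
  \<open>r\<close>, its other members form \<open>?T\<close>, whose factors multiply to 1. The case
  \<open>m = 0\<close> must be excluded, as the value there is 0.\<close>

lemma poly_cyclotomic_eq_3:
  assumes "r dvd 4" "m > 0"
  shows "poly (cyclotomic (r * 3 ^ m)) (cis (2 * pi / real r)) = 3"
proof -
  define u where "u = cis (2 * pi / real r)"
  note u = cis_order_dvd_4[OF assms(1) u_def]
  have r: "r > 0"
    using assms(1) by (auto intro!: Nat.gr0I)
  obtain l where m: "m = Suc l"
    using assms(2) by (cases m) auto
  define K where "K = r * 3 ^ l"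
  have N: "r * 3 ^ m = 3 * K" and "K > 0"
    using r by (simp_all add: K_def m)
  let ?S = "{d. d dvd 3 * K \<and> \<not> d dvd K}"
  let ?c = "\<lambda>d. poly (cyclotomic d) u"
  have uK: "u ^ K = 1"
    by (simp add: u(2) K_def)
  have "prod ?c ?S = poly (\<Sum>i<3. monom 1 K ^ i) u"
    using prod_cyclotomic_not_dvd[of "3 * K" K] \<open>K > 0\<close> by (simp flip: poly_prod)
  also have "\<dots> = 3"
    by (simp add: poly_sum poly_monom uK)
  finally have S: "prod ?c ?S = 3" .
  \<comment> \<open>A prime in the cofactor of \<open>d\<close> is 2 or 3: 3 would put
    \<open>d\<close> among the divisors of \<open>K\<close>, and 2 would make \<open>2 * d\<close>
    divide \<open>3 * K\<close>.\<close>
  have top: "d = 3 * K" if "d dvd 3 * K" "\<not> d dvd K" "even K \<Longrightarrow> \<not> 2 * d dvd 3 * K" for d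
  proof -
    from that(1) obtain c where c: "3 * K = d * c"
      by (elim dvdE)
    have "c = 1"
    proof (rule ccontr)
      assume "c \<noteq> 1"
      then obtain p where p: "prime p" "p dvd c"
        using prime_factor_nat by blast
      then obtain e where e: "3 * K = d * (p * e)"
        using c by (auto elim!: dvdE)
      have "p dvd r * 3 ^ m"
        unfolding N e by simp
      then have "p dvd 4 \<or> p dvd 3 ^ m"
        using p(1) assms(1) by (meson dvd_trans prime_dvd_mult_iff)
      then have "p = 2 \<or> p = 3"
        using p(1) prime_dvd_power[of p 2 2] prime_dvd_power[of p 3 m]
        by (auto simp: primes_dvd_imp_eq)
      then show False
      proof
        assume "p = 3"
        with e have "K = d * e" by simp
        with that(2) show False by simp
      next
        assume "p = 2"
        with e have *: "3 * K = 2 * d * e" by simp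
        then have "even (3 * K)" by simp
        then have "even K" by simp
        with that(3) * show False by (metis dvd_triv_left)
      qed
    qed
    with c show ?thesis by simp
  qed
  have "?c (3 * K) = 3"
  proof (cases "even r")
    case False
    have "r \<le> 4"
      using assms(1) by (rule dvd_imp_le) simp
    then have "r = 1 \<or> r = 2 \<or> r = 3 \<or> r = 4"
      using r by linarith
    then have "r = 1"
      using assms(1) False by (elim disjE) simp_all
    then have "odd K" by (simp add: K_def)
    then have "?S = {3 * K}"
      using top \<open>K > 0\<close> by (auto dest: dvd_imp_le)
    with S show ?thesis by simp
  next
    case True
    then obtain e where e: "r = 2 * e" by (elim evenE)
    define L where "L = e * 3 ^ l"
    have K: "K = 2 * L" "L > 0"
      using \<open>K > 0\<close> by (auto simp: K_def L_def e)
    let ?T = "{d. d dvd 3 * L \<and> \<not> d dvd L}"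
    \<comment> \<open>The remaining exponent \<open>3 ^ l\<close> is odd and keeps the sign; the
      geometric sum is then 1 - 1 + 1.\<close>
    have uL: "u ^ L = -1"
      using u(4)[OF True] by (simp add: L_def e power_mult)
    have "prod ?c ?T = poly (\<Sum>i<3. monom 1 L ^ i) u"
      using prod_cyclotomic_not_dvd[of "3 * L" L] K by (simp flip: poly_prod)
    also have "\<dots> = 1"
      by (simp add: poly_sum poly_monom uL numeral_3_eq_3)
    finally have T: "prod ?c ?T = 1" .
    have sub: "?T \<subseteq> ?S"
    proof safe
      fix d assume d: "d dvd 3 * L" "\<not> d dvd L"
      show "d dvd 3 * K" using dvd_mult[OF d(1), of 2] by (simp add: K)
      assume "d dvd K"
      \<comment> \<open>This difference is \<open>L\<close>, because
        \<open>K = 2 * L\<close>.\<close>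
      then have "d dvd 3 * L - K"
        using d(1) by (simp add: dvd_diff_nat)
      with d(2) show False by (simp add: K)
    qed
    have "?S = insert (3 * K) ?T"
    proof (intro equalityI subsetI)
      fix d assume d: "d \<in> ?S"
      show "d \<in> insert (3 * K) ?T"
      proof (rule ccontr)
        assume *: "d \<notin> insert (3 * K) ?T"
        then have "2 * d dvd 3 * K"
          using top d by auto
        then have "d dvd 3 * L"
          by (simp add: K)
        with * have "d dvd K"
          by (simp add: K)
        with d show False by simp
      qed
    next
      fix d assume "d \<in> insert (3 * K) ?T"
      with sub \<open>K > 0\<close> show "d \<in> ?S"
        by (auto dest: dvd_imp_le)
    qed
    moreover have "3 * K \<notin> ?T"
      using K by (auto dest: dvd_imp_le)
    ultimately have "prod ?c ?S = ?c (3 * K) * prod ?c ?T"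
      using K by simp
    with S T show ?thesis by simp
  qed
  then show ?thesis
    by (simp only: N u_def)
qed

text \<open>Settles the exponent 0 in the equivalence below: the value 0 is divisible by 3.\<close>

lemma poly_cyclotomic_cis:
  assumes "r > 0"
  shows "poly (cyclotomic r) (cis (2 * pi / real r)) = 0"
  unfolding cyclotomic_def poly_prod using assms
  by (intro prod_zero bexI[of _ 1]) auto

lemma three_dvd_cyclotomic_iff:
  assumes "r dvd 4" "n > 0"
  shows "three_dvd (poly (cyclotomic n) (cis (2 * pi / real r))) \<longleftrightarrow> (\<exists>m. n = r * 3 ^ m)"
proof
  assume "\<exists>m. n = r * 3 ^ m"
  then obtain m where n: "n = r * 3 ^ m" by auto
  have "r > 0"
    using assms(1) by (auto intro!: Nat.gr0I)
  then have "poly (cyclotomic n) (cis (2 * pi / real r)) \<in> {0, 3}"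
    using poly_cyclotomic_eq_3[OF assms(1), of m] poly_cyclotomic_cis[of r]
    by (cases "m = 0") (auto simp: n)
  then show "three_dvd (poly (cyclotomic n) (cis (2 * pi / real r)))"
    by (auto simp: three_dvd_def intro: Ints_imp_gauss_ints)
qed (use three_dvd_cyclotomic_imp[OF assms] in auto)

section \<open>The coefficients of the Lucas atoms\<close>

text \<open>Used with \<open>A\<close> = (1+q)^2 and \<open>B\<close> = q to obtain the gamma
  coefficients. The vanishing clause matches the definition of \<open>lucas_gamma\<close>.\<close>

lemma homogeneous_prod_expansion:
  fixes A B :: "'a :: comm_ring_1 poly"
  assumes "finite K"
  shows "\<exists>g. (\<forall>j. card K < j \<longrightarrow> g j = 0) \<and>
    (\<Prod>k\<in>K. A + smult (c k) B) = (\<Sum>j\<le>card K. smult (g j) (B ^ j * A ^ (card K - j)))"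
  using assms
proof (induction K rule: finite_induct)
  case empty
  show ?case
    by (intro exI[of _ "\<lambda>j. if j = 0 then 1 else 0"]) auto
next
  case (insert x K)
  let ?m = "card K"
  obtain g where g: "\<And>j. ?m < j \<Longrightarrow> g j = 0"
    "(\<Prod>k\<in>K. A + smult (c k) B) = (\<Sum>j\<le>?m. smult (g j) (B ^ j * A ^ (?m - j)))"
    using insert.IH by blast
  \<comment> \<open>A factor \<open>A + smult (c x) B\<close> keeps \<open>g\<close> through
    \<open>A\<close> and shifts it by one place through \<open>B\<close>.\<close>
  define h where "h j = g j + (case j of 0 \<Rightarrow> 0 | Suc i \<Rightarrow> c x * g i)" for j
  let ?t = "\<lambda>f. \<Sum>j\<le>Suc ?m. smult (f j) (B ^ j * A ^ (Suc ?m - j))"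
  \<comment> \<open>The additional top summand vanishes because
    \<open>g (Suc ?m) = 0\<close>.\<close>
  have 1: "A * (\<Sum>j\<le>?m. smult (g j) (B ^ j * A ^ (?m - j))) = ?t g"
    using g(1)[of "Suc ?m"]
    by (simp add: sum_distrib_left Suc_diff_le mult_ac)
  have 2: "smult (c x) B * (\<Sum>j\<le>?m. smult (g j) (B ^ j * A ^ (?m - j))) =
      ?t (\<lambda>j. case j of 0 \<Rightarrow> 0 | Suc i \<Rightarrow> c x * g i)"
    unfolding sum.atMost_Suc_shift by (simp add: sum_distrib_left mult_ac)
  have "(\<Prod>k\<in>insert x K. A + smult (c k) B) = ?t h"
    unfolding prod.insert[OF insert.hyps] g(2) distrib_right 1 2
    by (simp only: h_def smult_add_left sum.distrib)
  moreover have "h j = 0" if "Suc ?m < j" for j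
    using that g(1) by (auto simp: h_def split: nat.split)
  ultimately show ?case
    using insert.hyps by (intro exI[of _ h]) auto
qed

text \<open>Conjugate roots z, 1/z give q^2 - 2 cos(x) q + 1 = (1+q)^2 - (2 + 2 cos(x)) q, where x
  is the argument of z. For \<open>n \<ge> 3\<close> no totative is fixed by \<open>k\<close> ->
  \<open>n - k\<close>, so the roots split into such pairs.\<close>

lemma cyclotomic_conjugate_pairs:
  assumes "n \<ge> 3"
  obtains K :: "nat set" and c where "finite K" "totient n = 2 * card K"
    "cyclotomic n = (\<Prod>k\<in>K. [:1, 1:] ^ 2 + smult (c k) (monom 1 1))"
proof -
  define K where "K = {k\<in>totatives n. 2 * k < n}"
  define z where "z k = cis (2 * pi * real k / real n)" for k
  define c where "c k = complex_of_real (- 2 - 2 * cos (2 * pi * real k / real n))" for k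
  have fin: "finite K"
    by (simp add: K_def)
  have lt: "k < n" if "k \<in> totatives n" for k
    using totatives_less[OF that] assms by simp
  have mirror: "n - k \<in> totatives n" if "k \<in> totatives n" for k
    using that lt[OF that] gcd_diff2_nat[of k n]
    by (simp add: in_totatives_iff coprime_iff_gcd_eq_1)
  have half: "2 * k \<noteq> n" if "k \<in> totatives n" for k
  proof
    assume "2 * k = n"
    then have "k dvd n" by auto
    with that have "k = 1"
      by (auto simp: in_totatives_iff coprime_absorb_left)
    with \<open>2 * k = n\<close> assms show False by simp
  qed
  have split: "totatives n = K \<union> (\<lambda>k. n - k) ` K"
  proof (intro equalityI subsetI)
    fix k assume k: "k \<in> totatives n"
    show "k \<in> K \<union> (\<lambda>k. n - k) ` K"
    proof (cases "2 * k < n")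
      case False
      then have "n - k \<in> K" "k = n - (n - k)"
        using half[OF k] mirror[OF k] lt[OF k] by (auto simp: K_def)
      then show ?thesis by blast
    qed (use k in \<open>auto simp: K_def\<close>)
  qed (use mirror in \<open>auto simp: K_def\<close>)
  have disj: "K \<inter> (\<lambda>k. n - k) ` K = {}"
    by (auto simp: K_def)
  have inj: "inj_on (\<lambda>k. n - k) K"
    using lt by (intro inj_onI) (auto simp: K_def dest!: lt)
  have "totient n = 2 * card K"
    unfolding totient_def split using fin disj inj by (simp add: card_Un_disjoint card_image)
  moreover have "cyclotomic n = (\<Prod>k\<in>K. [:1, 1:] ^ 2 + smult (c k) (monom 1 1))"
  proof -
    have pair: "[:- z k, 1:] * [:- z (n - k), 1:] = [:1, 1:] ^ 2 + smult (c k) (monom 1 1)"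
      if "k \<in> K" for k
    proof -
      have "k < n" using that lt by (auto simp: K_def)
      then have "2 * pi * real (n - k) / real n = 2 * pi - 2 * pi * real k / real n"
        by (simp add: of_nat_diff field_simps)
      then have "z (n - k) = cnj (z k)"
        by (simp add: z_def complex_eq_iff)
      moreover have "cnj (z k) * z k = 1"
        by (simp add: z_def cis_mult cis_cnj)
      moreover have "- z k - cnj (z k) = 2 + c k"
        by (simp add: z_def c_def complex_eq_iff)
      ultimately show ?thesis
        by (simp add: power2_eq_square monom_Suc monom_0 add.commute)
    qed
    have "cyclotomic n = (\<Prod>k\<in>K. [:- z k, 1:]) * (\<Prod>k\<in>K. [:- z (n - k), 1:])"
      unfolding cyclotomic_def split z_def[symmetric] using fin disj inj
      by (simp add: prod.union_disjoint prod.reindex)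
    also have "\<dots> = (\<Prod>k\<in>K. [:1, 1:] ^ 2 + smult (c k) (monom 1 1))"
      unfolding prod.distrib[symmetric] by (intro prod.cong pair refl)
    finally show ?thesis .
  qed
  ultimately show ?thesis
    using that fin by blast
qed

section \<open>Uniqueness and integrality of the gamma coefficients\<close>

definition gamma_sum :: "nat \<Rightarrow> (nat \<Rightarrow> complex) \<Rightarrow> complex poly" where
  "gamma_sum m g = (\<Sum>j\<le>m. smult (g j) (monom 1 j * [:1, 1:] ^ (2 * m - 2 * j)))"

text \<open>The \<open>j\<close>-th summand starts with q^j and coefficient 1. This unitriangular
  system determines each \<open>g k\<close> from the earlier ones without division, giving both
  uniqueness and integrality.\<close>

lemma coeff_gamma_sum:
  assumes "k \<le> m"
  shows "coeff (gamma_sum m g) k = g k + (\<Sum>j<k. g j * of_nat ((2 * m - 2 * j) choose (k - j)))"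
proof -
  let ?b = "\<lambda>j. coeff (smult (g j) (monom 1 j * [:1, 1:] ^ (2 * m - 2 * j))) k"
  have "coeff (gamma_sum m g) k = (\<Sum>j\<in>{..m}. ?b j)"
    by (simp add: gamma_sum_def coeff_sum)
  also have "\<dots> = (\<Sum>j\<in>{..k}. ?b j)"
    using assms by (intro sum.mono_neutral_right) (auto simp: coeff_monom_mult)
  also have "\<dots> = (\<Sum>j\<in>{..k}. g j * of_nat ((2 * m - 2 * j) choose (k - j)))"
    using assms by (intro sum.cong) (auto simp: coeff_monom_mult coeff_linear_poly_power)
  also have "\<dots> = g k + (\<Sum>j<k. g j * of_nat ((2 * m - 2 * j) choose (k - j)))"
    by (simp add: lessThan_Suc_atMost[symmetric])
  finally show ?thesis .
qed

lemma gamma_sum_inject: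
  assumes "gamma_sum m g = gamma_sum m h" "k \<le> m"
  shows "g k = h k"
  using assms(2)
proof (induction k rule: less_induct)
  case (less k)
  have "(\<Sum>j<k. g j * of_nat ((2 * m - 2 * j) choose (k - j))) =
      (\<Sum>j<k. h j * of_nat ((2 * m - 2 * j) choose (k - j)))"
    using less by (intro sum.cong) auto
  then show ?case
    using coeff_gamma_sum[OF less.prems, of g] coeff_gamma_sum[OF less.prems, of h] assms(1) by simp
qed

lemma gamma_sum_Ints:
  assumes "\<And>i. coeff (gamma_sum m g) i \<in> \<int>" "k \<le> m"
  shows "g k \<in> \<int>"
  using assms(2)
proof (induction k rule: less_induct)
  case (less k)
  have "g k = coeff (gamma_sum m g) k - (\<Sum>j<k. g j * of_nat ((2 * m - 2 * j) choose (k - j)))"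
    by (simp add: coeff_gamma_sum[OF less.prems])
  also have "\<dots> \<in> \<int>"
    using assms(1) less by (intro Ints_diff Ints_sum Ints_mult) auto
  finally show ?case .
qed

text \<open>Resolves the \<open>THE\<close>: existence comes from the conjugate pairs, uniqueness
  from the triangular system up to \<open>m\<close> and the vanishing clause beyond it.\<close>

lemma lucas_gamma_eqs:
  assumes "n \<ge> 3"
  obtains m where "totient n = 2 * m" "m > 0" "gamma_sum m (lucas_gamma n) = cyclotomic n"
    "\<And>j. lucas_gamma n j \<in> \<int>"
proof -
  obtain K c where K: "finite K" "totient n = 2 * card (K :: nat set)"
    "cyclotomic n = (\<Prod>k\<in>K. [:1, 1:] ^ 2 + smult (c k) (monom 1 1))"
    using cyclotomic_conjugate_pairs[OF assms] by blast
  define m where "m = card K"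
  have m: "totient n = 2 * m"
    by (simp add: K m_def)
  let ?P = "\<lambda>g. (\<forall>j. m < j \<longrightarrow> g j = 0) \<and> cyclotomic n = gamma_sum m g"
  obtain g where g: "\<And>j. m < j \<Longrightarrow> g j = 0"
    "cyclotomic n = (\<Sum>j\<le>m. smult (g j) (monom 1 1 ^ j * ([:1, 1:] ^ 2) ^ (m - j)))"
    using homogeneous_prod_expansion[OF K(1), of "[:1, 1:] ^ 2" c "monom 1 1"]
    unfolding K(3) m_def by blast
  have "?P g"
    using g by (auto simp: gamma_sum_def monom_power power_mult[symmetric] diff_mult_distrib2)
  moreover have "h = g" if "?P h" for h
  proof
    fix j
    show "h j = g j"
      using that \<open>?P g\<close> gamma_sum_inject[of m h g j] by (cases "j \<le> m") auto
  qed
  moreover have "lucas_gamma n = (THE g. ?P g)"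
    by (simp add: lucas_gamma_def gamma_sum_def m)
  ultimately have eq: "lucas_gamma n = g"
    using the_equality[of ?P g] by blast
  have cyc: "gamma_sum m (lucas_gamma n) = cyclotomic n"
    using \<open>?P g\<close> eq by simp
  have "lucas_gamma n j \<in> \<int>" for j
    using gamma_sum_Ints[of m "lucas_gamma n" j] coeff_cyclotomic_Ints[of n] g(1)[of j] eq
    by (cases "j \<le> m") (auto simp: cyc)
  moreover have "m > 0"
    using totient_gt_0_iff[of n] assms m by simp
  ultimately show ?thesis
    using that m cyc by blast
qed

section \<open>Evaluation of the Lucas atoms\<close>

theorem theorem6p5:
  fixes n :: nat
  assumes "n \<ge> 3"
  shows "lucas_atom n 0 0 = 0
    \<and> (\<forall>e\<in>{1, -1}. lucas_atom n e 0 = 1)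
    \<and> (\<forall>e\<in>{1, -1}. int_dvd 3 (lucas_atom n 0 e) \<longleftrightarrow> (\<exists>m::nat. m \<ge> 1 \<and> n = 2 * 3 ^ m))
    \<and> (\<forall>e\<in>{1, -1}. int_dvd 3 (lucas_atom n e 1) \<longleftrightarrow> (\<exists>m::nat. n = 4 * 3 ^ m))
    \<and> (\<forall>e\<in>{1, -1}. int_dvd 3 (lucas_atom n e (-1)) \<longleftrightarrow> (\<exists>m::nat. n = 3 * 3 ^ m))"
proof -
  obtain M where M: "totient n = 2 * M" "M > 0"
    and cyc: "gamma_sum M (lucas_gamma n) = cyclotomic n"
    and int: "\<And>j. lucas_gamma n j \<in> \<int>"
    using lucas_gamma_eqs[OF assms] by blast
  let ?g = "lucas_gamma n"
  note ginty = Ints_imp_gauss_ints[OF int]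
  have atom: "lucas_atom n s t = (\<Sum>j\<le>M. ?g j * (s ^ (2 * M - 2 * j) * (- t) ^ j))" for s t
    by (simp add: lucas_atom_def M mult.assoc)
  have atom_Ints: "lucas_atom n s t \<in> \<int>" if "s \<in> \<int>" "t \<in> \<int>" for s t
    unfolding atom using that int by (intro Ints_sum Ints_mult Ints_power Ints_minus)
  have eval: "poly (cyclotomic n) q = (\<Sum>j\<le>M. ?g j * (q ^ j * (1 + q) ^ (2 * M - 2 * j)))" for q
    by (simp add: gamma_sum_def poly_sum poly_monom flip: cyc)
  \<comment> \<open>Only the square of \<open>s\<close> enters, so the sign of \<open>e\<close> in
    the first argument is irrelevant.\<close>
  have pow: "s ^ (2 * M - 2 * j) = (s\<^sup>2) ^ (M - j)" for s :: complex and j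
    by (simp add: diff_mult_distrib2 power_mult[symmetric])
  \<comment> \<open>At \<open>s = 0\<close> only \<open>j = M\<close> survives, where the exponent
    is 0.\<close>
  have lead: "(\<Sum>j\<le>M. ?g j * ((0 :: complex) ^ (2 * M - 2 * j) * f j)) = ?g M * f M" for f
  proof -
    have "(\<Sum>j\<le>M. ?g j * ((0 :: complex) ^ (2 * M - 2 * j) * f j)) = (\<Sum>j\<in>{M}. ?g j * (0 ^ (2 * M - 2 * j) * f j))"
      by (intro sum.mono_neutral_right) auto
    then show ?thesis by simp
  qed
  have a: "lucas_atom n 0 0 = 0"
    unfolding atom lead using M by simp
  have b: "lucas_atom n e 0 = 1" if "e \<in> {1, -1}" for e
  proof -
    have "lucas_atom n e 0 = (\<Sum>j\<in>{0}. ?g j * (e ^ (2 * M - 2 * j) * (- 0) ^ j))"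
      unfolding atom by (intro sum.mono_neutral_right) auto
    also have "\<dots> = ?g 0"
      using that by (auto simp: pow)
    also have "\<dots> = coeff (cyclotomic n) 0"
      using coeff_gamma_sum[of 0 M ?g] cyc by simp
    also have "\<dots> = 1"
      using assms by (intro coeff_0_cyclotomic) simp
    finally show ?thesis .
  qed
  have c: "int_dvd 3 (lucas_atom n 0 e) \<longleftrightarrow> (\<exists>m::nat. m \<ge> 1 \<and> n = 2 * 3 ^ m)" if e: "e \<in> {1, -1}" for e
  proof -
    \<comment> \<open>So \<open>e ^ M\<close> is a unit, its own inverse; it absorbs the sign of the
      second argument.\<close>
    have eM: "e ^ M * e ^ M = 1"
      using e by (auto simp flip: power_mult_distrib)
    have eG: "e \<in> gauss_ints" "e \<in> \<int>"
      using e by (auto intro: Ints_imp_gauss_ints)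
    have "lucas_atom n 0 e = e ^ M * (?g M * (-1) ^ M)"
      unfolding atom lead using power_minus[of e M] by (simp add: mult_ac)
    also have "?g M * (-1) ^ M = poly (cyclotomic n) (-1)"
      using lead[of "\<lambda>j. (-1) ^ j"] by (simp add: eval mult.commute)
    finally have "int_dvd 3 (lucas_atom n 0 e) \<longleftrightarrow> three_dvd (poly (cyclotomic n) (-1))"
      using atom_Ints[of 0 e] eG eM by (simp add: int_dvd_3_iff three_dvd_mult_unit[of _ "e ^ M"] gauss_ints_power)
    also have "\<dots> \<longleftrightarrow> (\<exists>m. n = 2 * 3 ^ m)"
      using three_dvd_cyclotomic_iff[of 2 n] assms by simp
    also have "\<dots> \<longleftrightarrow> (\<exists>m::nat. m \<ge> 1 \<and> n = 2 * 3 ^ m)"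
    proof -
      \<comment> \<open>Exponent 0 would give \<open>n = 2\<close>, against
        \<open>n \<ge> 3\<close>.\<close>
      have "m \<ge> 1" if "n = 2 * 3 ^ m" for m
        using that assms by (cases m) auto
      then show ?thesis by blast
    qed
    finally show ?thesis .
  qed
  have d: "int_dvd 3 (lucas_atom n e 1) \<longleftrightarrow> (\<exists>m::nat. n = 4 * 3 ^ m)" if e: "e \<in> {1, -1}" for e
  proof -
    have iG: "\<i> \<in> gauss_ints"
      by (simp add: gauss_ints_def)
    have e1: "e \<in> \<int>" "e\<^sup>2 = 1"
      using e by auto
    have i2: "(1 + \<i>)\<^sup>2 = 2 * \<i>"
      by (simp add: power2_eq_square algebra_simps)
    \<comment> \<open>The unit \<open>(-\<i>) ^ M\<close> aligns the two sums: their
      \<open>j\<close>-th terms are \<open>?g j * \<i> ^ M\<close> times \<open>2 ^ (M - j)\<close>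
      and \<open>(-1) ^ (M - j)\<close>, congruent modulo 3.\<close>
    have "three_dvd (poly (cyclotomic n) \<i>) \<longleftrightarrow>
        three_dvd (\<Sum>j\<le>M. ((-\<i>) ^ M) * (?g j * (e ^ (2 * M - 2 * j) * (- 1) ^ j)))"
      unfolding eval pow e1 i2
    proof (rule three_dvd_sum_cong)
      fix j assume "j \<in> {..M}"
      then have M_eq: "M = j + (M - j)" by simp
      have 1: "\<i> ^ j * (2 * \<i>) ^ (M - j) = 2 ^ (M - j) * \<i> ^ M"
        by (subst (3) M_eq) (simp add: power_add power_mult_distrib)
      have "(- 1 :: complex) ^ M * (- 1) ^ j = (- 1) ^ (M - j) * ((- 1) ^ j * (- 1) ^ j)"
        by (subst (1) M_eq) (simp only: power_add mult_ac)
      also have "(- 1 :: complex) ^ j * (- 1) ^ j = 1"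
        by (simp flip: power_mult_distrib)
      finally have 2: "(-\<i>) ^ M * (- 1) ^ j = (- 1) ^ (M - j) * \<i> ^ M"
        by (simp add: power_minus[of \<i>] mult_ac)
      have "?g j * (\<i> ^ j * (2 * \<i>) ^ (M - j)) - (-\<i>) ^ M * (?g j * (1 ^ (M - j) * (- 1) ^ j)) =
          (2 ^ (M - j) - (-1) ^ (M - j)) * (\<i> ^ M * ?g j)"
        unfolding 1 using 2 by (simp add: algebra_simps)
      also have "three_dvd \<dots>"
        using iG ginty by (intro three_dvd_mult three_dvd_power_diff gauss_ints_mult gauss_ints_power)
          (auto simp: three_dvd_def intro: Ints_imp_gauss_ints)
      finally show "three_dvd (?g j * (\<i> ^ j * (2 * \<i>) ^ (M - j)) - (-\<i>) ^ M * (?g j * (1 ^ (M - j) * (- 1) ^ j)))" .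
    qed
    also have "\<dots> \<longleftrightarrow> three_dvd ((-\<i>) ^ M * lucas_atom n e 1)"
      by (simp add: atom sum_distrib_left)
    also have "\<dots> \<longleftrightarrow> three_dvd (lucas_atom n e 1)"
      using iG by (intro three_dvd_mult_unit[of _ "\<i> ^ M"] gauss_ints_power)
        (auto simp: gauss_ints_def simp flip: power_mult_distrib)
    finally have "int_dvd 3 (lucas_atom n e 1) \<longleftrightarrow> three_dvd (poly (cyclotomic n) \<i>)"
      using atom_Ints[of e 1] e1 by (simp add: int_dvd_3_iff)
    also have "\<dots> \<longleftrightarrow> (\<exists>m. n = 4 * 3 ^ m)"
      using three_dvd_cyclotomic_iff[of 4 n] assms by simp
    finally show ?thesis .
  qed
  have f: "int_dvd 3 (lucas_atom n e (-1)) \<longleftrightarrow> (\<exists>m::nat. n = 3 * 3 ^ m)" if e: "e \<in> {1, -1}" for e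
  proof -
    have e1: "e \<in> \<int>" "e\<^sup>2 = 1"
      using e by auto
    have "three_dvd (poly (cyclotomic n) 1) \<longleftrightarrow> three_dvd (lucas_atom n e (-1))"
      unfolding eval atom pow e1
    proof (rule three_dvd_sum_cong)
      fix j
      \<comment> \<open>At q = 1 the square (1+q)^2 is 4, which is congruent to 1 modulo 3.\<close>
      have "?g j * (1 ^ j * ((1 + 1)\<^sup>2) ^ (M - j)) - ?g j * (1 ^ (M - j) * (- (- 1)) ^ j) =
          (4 ^ (M - j) - 1 ^ (M - j)) * ?g j"
        by (simp add: algebra_simps)
      also have "three_dvd \<dots>"
        using ginty by (intro three_dvd_mult three_dvd_power_diff)
          (auto simp: three_dvd_def intro: Ints_imp_gauss_ints)
      finally show "three_dvd (?g j * (1 ^ j * ((1 + 1)\<^sup>2) ^ (M - j)) - ?g j * (1 ^ (M - j) * (- (- 1)) ^ j))" .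
    qed
    then have "int_dvd 3 (lucas_atom n e (-1)) \<longleftrightarrow> three_dvd (poly (cyclotomic n) 1)"
      using atom_Ints[of e "-1"] e1 by (simp add: int_dvd_3_iff)
    also have "\<dots> \<longleftrightarrow> (\<exists>m. n = 3 ^ m)"
      using three_dvd_cyclotomic_iff[of 1 n] assms by simp
    \<comment> \<open>As \<open>n \<ge> 3\<close> excludes exponent 0, one factor 3 can be split
      off.\<close>
    also have "\<dots> \<longleftrightarrow> (\<exists>m::nat. n = 3 * 3 ^ m)"
    proof
      assume "\<exists>m. n = 3 ^ m"
      then obtain m where "n = 3 ^ m" ..
      with assms show "\<exists>m. n = 3 * 3 ^ m" by (cases m) auto
    qed (metis power_Suc)
    finally show ?thesis .
  qed
  show ?thesis
    by (intro conjI ballI a b c d f)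
qed

end
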